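(* Let $\Omega$ be a semigroup. A Rota-Baxter family $\{R_\lambda\mid\lambda\in\Omega\}$ of weight $0$ on a Hom-anti-associative algebra $(\mathscr{A},\ast,\alpha)$ induces a Hom-rhizaform family algebra $(\mathscr{A},\{\prec_\lambda,\succ_\lambda\mid\lambda\in\Omega\},\alpha)$, where the operations $\prec_\lambda$ and $\succ_\lambda$ are defined by $$a\prec_\lambda b=a\ast R_\lambda(b),\qquad a\succ_\lambda b=R_\lambda(a)\ast b,$$ for all $\lambda\in\Omega$ and $a,b\in\mathscr{A}$.
   Context: All vector spaces are over a fixed field; the product of $\lambda,\omega$ in the semigroup $\Omega$ is written $\lambda\omega$. A Hom-anti-associative algebra $(\mathscr{A},\ast,\alpha)$ is a vector space with a bilinear product $\ast$ and a linear map $\alpha:\mathscr{A}\to\mathscr{A}$ such that $\alpha(x)\ast(y\ast z)=-(x\ast y)\ast\alpha(z)$ for all $x,y,z\in\mathscr{A}$. A Rota-Baxter family of weight $0$ on $(\mathscr{A},\ast,\alpha)$ is a collection of linear operators $R_\lambda:\mathscr{A}\to\mathscr{A}$, $\lambda\in\Omega$, such that $\alpha\circ R_\lambda=R_\lambda\circ\alpha$ and $R_\lambda(a)\ast R_\omega(b)=R_{\lambda\omega}\big(R_\lambda(a)\ast b+a\ast R_\omega(b)\big)$ for all $a,b\in\mathscr{A}$ and $\lambda,\omega\in\Omega$. A Hom-rhizaform family algebra $(\mathscr{A},\{\prec_\omega,\succ_\omega\mid\omega\in\Omega\},\alpha)$ is a vector space $\mathscr{A}$ with a family of bilinear operations $\prec_\omega,\succ_\omega$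 ($\omega\in\Omega$) and a linear map $\alpha:\mathscr{A}\to\mathscr{A}$ such that for all $x,y,z\in\mathscr{A}$ and $\lambda,\omega\in\Omega$: $\alpha(x\prec_\omega y)=\alpha(x)\prec_\omega\alpha(y)$, $\alpha(x\succ_\omega y)=\alpha(x)\succ_\omega\alpha(y)$, and $$(x\prec_\lambda y)\prec_\omega\alpha(z)=-\alpha(x)\prec_{\lambda\omega}(y\prec_\omega z+y\succ_\lambda z),$$ $$(x\succ_\lambda y)\prec_\omega\alpha(z)=-\alpha(x)\succ_\lambda(y\prec_\omega z),$$ $$(x\prec_\omega y+x\succ_\lambda y)\succ_{\lambda\omega}\alpha(z)=-\alpha(x)\succ_\lambda(y\succ_\omega z).$$
   Formalization: The twist α is additionally assumed multiplicative, α(x∗y)=α(x)∗α(y); without this the claim fails, e.g. f∗f=g, other products 0, α=2·id, R_ω(f)=f, R_ω(g)=g/2, where α(f≺f)=2g but α(f)≺α(f)=4g. *)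

theory Defs
  imports Complex_Main
begin

definition bilinear_operation ::
    "('k::field \<Rightarrow> 'a::ab_group_add \<Rightarrow> 'a) \<Rightarrow> ('a \<Rightarrow> 'a \<Rightarrow> 'a) \<Rightarrow> bool"
  where "bilinear_operation scale m \<longleftrightarrow>
    (\<forall>x. Vector_Spaces.linear scale scale (\<lambda>y. m x y)) \<and>
    (\<forall>y. Vector_Spaces.linear scale scale (\<lambda>x. m x y))"

locale hom_anti_associative_algebra = vector_space scale
  for scale :: "'k::field \<Rightarrow> 'a::ab_group_add \<Rightarrow> 'a" +
  fixes prd :: "'a \<Rightarrow> 'a \<Rightarrow> 'a"  (infixl "\<^bold>*" 70)
    and \<alpha> :: "'a \<Rightarrow> 'a"
  assumes bilinear_prd: "bilinear_operation scale prd"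
    and linear_twist: "Vector_Spaces.linear scale scale \<alpha>"
    and hom_anti_assoc: "\<alpha> x \<^bold>* (y \<^bold>* z) = - ((x \<^bold>* y) \<^bold>* \<alpha> z)"

(* Not part of hom_anti_associative_algebra, whose twist may fail to be multiplicative;
   the twist of a hom_rhizaform_family_algebra has to respect all its operations. *)
definition multiplicative_twist :: "('a \<Rightarrow> 'a \<Rightarrow> 'a) \<Rightarrow> ('a \<Rightarrow> 'a) \<Rightarrow> bool"
  where "multiplicative_twist m \<alpha> \<longleftrightarrow> (\<forall>x y. \<alpha> (m x y) = m (\<alpha> x) (\<alpha> y))"

(* The semigroup Omega is the type 'w. *)
locale rota_baxter_family_weight_0 = hom_anti_associative_algebra scale prd \<alpha>
  for scale :: "'k::field \<Rightarrow> 'a::ab_group_add \<Rightarrow> 'a"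
    and prd :: "'a \<Rightarrow> 'a \<Rightarrow> 'a"  (infixl "\<^bold>*" 70)
    and \<alpha> :: "'a \<Rightarrow> 'a" +
  fixes R :: "'w::semigroup_mult \<Rightarrow> 'a \<Rightarrow> 'a"
  assumes linear_R: "Vector_Spaces.linear scale scale (R l)"
    and twist_R_commute: "\<alpha> \<circ> R l = R l \<circ> \<alpha>"
    and rota_baxter: "R l a \<^bold>* R w b = R (l * w) (R l a \<^bold>* b + a \<^bold>* R w b)"

locale hom_rhizaform_family_algebra = vector_space scale
  for scale :: "'k::field \<Rightarrow> 'a::ab_group_add \<Rightarrow> 'a" +
  fixes prec :: "'w::semigroup_mult \<Rightarrow> 'a \<Rightarrow> 'a \<Rightarrow> 'a"
    and succ :: "'w \<Rightarrow> 'a \<Rightarrow> 'a \<Rightarrow> 'a"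
    and \<alpha> :: "'a \<Rightarrow> 'a"
  assumes bilinear_prec: "bilinear_operation scale (prec w)"
    and bilinear_succ: "bilinear_operation scale (succ w)"
    and linear_twist: "Vector_Spaces.linear scale scale \<alpha>"
    and twist_prec: "\<alpha> (prec w x y) = prec w (\<alpha> x) (\<alpha> y)"
    and twist_succ: "\<alpha> (succ w x y) = succ w (\<alpha> x) (\<alpha> y)"
    and prec_prec: "prec w (prec l x y) (\<alpha> z) =
      - prec (l * w) (\<alpha> x) (prec w y z + succ l y z)"
    and succ_prec: "prec w (succ l x y) (\<alpha> z) = - succ l (\<alpha> x) (prec w y z)"
    and succ_succ: "succ (l * w) (prec w x y + succ l x y) (\<alpha> z) =
      - succ l (\<alpha> x) (succ w y z)"

end

theory Submission
  imports Defs
begin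

text \<open>
  In each of the three rhizaform identities the twist commutes with the operators, so an
  operator applied to a twisted element can be moved inside the twist. The
  identity is then an instance of Hom-anti-associativity, applied to a triple whose entries
  are \<open>x\<close>, \<open>y\<close>, \<open>z\<close> with operators applied to two of them:
  \<open>(x, R l y, R w z)\<close>, \<open>(R l x, y, R w z)\<close> and \<open>(R l x, R w y, z)\<close> respectively.
  In the first and last triple the two operators sit on adjacent entries, and the product of
  these is rewritten by the Rota-Baxter identity; this is where the index \<open>l * w\<close> and the
  sum of both operations come from. In the middle triple they are separated by \<open>y\<close>, so
  no such rewriting occurs.
\<close>

lemma bilinear_operation_compose_right:
  assumes "bilinear_operation scale m" "Vector_Spaces.linear scale scale f"
  shows "bilinear_operation scale (\<lambda>a b. m a (f b))"
  using assms Vector_Spaces.linear_compose[of scale scale f scale]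
  by (auto simp: bilinear_operation_def comp_def)

lemma bilinear_operation_compose_left:
  assumes "bilinear_operation scale m" "Vector_Spaces.linear scale scale f"
  shows "bilinear_operation scale (\<lambda>a b. m (f a) b)"
  using assms Vector_Spaces.linear_compose[of scale scale f scale]
  by (auto simp: bilinear_operation_def comp_def)

theorem proposition6p6:
  fixes scale :: "'k::field \<Rightarrow> 'a::ab_group_add \<Rightarrow> 'a"
    and prd :: "'a \<Rightarrow> 'a \<Rightarrow> 'a"
    and \<alpha> :: "'a \<Rightarrow> 'a"
    and R :: "'w::semigroup_mult \<Rightarrow> 'a \<Rightarrow> 'a"
  assumes "rota_baxter_family_weight_0 scale prd \<alpha> R"
    and "multiplicative_twist prd \<alpha>"
  shows "hom_rhizaform_family_algebra scale
    (\<lambda>l a b. prd a (R l b)) (\<lambda>l a b. prd (R l a) b) \<alpha>"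
proof -
  interpret rota_baxter_family_weight_0 scale prd \<alpha> R by fact
  have twist_R: "R l (\<alpha> x) = \<alpha> (R l x)" for l x
    using twist_R_commute[of l] by (metis comp_apply)
  have twist_prd: "\<alpha> (prd x y) = prd (\<alpha> x) (\<alpha> y)" for x y
    using assms(2) by (simp add: multiplicative_twist_def)
  have anti: "prd (prd x y) (\<alpha> z) = - prd (\<alpha> x) (prd y z)" for x y z
    by (simp add: hom_anti_assoc)
  have RB: "R (l * w) (prd a (R w b) + prd (R l a) b) = prd (R l a) (R w b)" for l w a b
    by (simp add: rota_baxter add.commute)
  show ?thesis
  proof (intro hom_rhizaform_family_algebra.intro hom_rhizaform_family_algebra_axioms.intro)
    fix l w :: 'w and x y z :: 'a
    show "vector_space scale"
      by (rule vector_space_axioms)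
    show "bilinear_operation scale (\<lambda>a b. prd a (R w b))"
      using bilinear_prd linear_R by (rule bilinear_operation_compose_right)
    show "bilinear_operation scale (\<lambda>a b. prd (R w a) b)"
      using bilinear_prd linear_R by (rule bilinear_operation_compose_left)
    show "Vector_Spaces.linear scale scale \<alpha>"
      by (rule linear_twist)
    show "\<alpha> (prd x (R w y)) = prd (\<alpha> x) (R w (\<alpha> y))"
      by (simp add: twist_prd twist_R)
    show "\<alpha> (prd (R w x) y) = prd (R w (\<alpha> x)) (\<alpha> y)"
      by (simp add: twist_prd twist_R)
    show "prd (prd x (R l y)) (R w (\<alpha> z)) =
        - prd (\<alpha> x) (R (l * w) (prd y (R w z) + prd (R l y) z))"
      by (simp only: twist_R RB anti)
    show "prd (prd (R l x) y) (R w (\<alpha> z)) = - prd (R l (\<alpha> x)) (prd y (R w z))"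
      by (simp only: twist_R anti)
    show "prd (R (l * w) (prd x (R w y) + prd (R l x) y)) (\<alpha> z) =
        - prd (R l (\<alpha> x)) (prd (R w y) z)"
      by (simp only: twist_R RB anti)
  qed
qed

end
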